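(* Assume the decay of correlations assumption (DC) stated in the context. Let $d\ge1$, let $g_j:\mathcal Y_j\to\mathbb R^d$, $j\ge0$, be a sequence of functions, let $r\in B$ be nonnegative with $\int r\,d\mu=1$, let $d\nu=r\,d\mu$, and let $(b_n)$ be a sequence of positive numbers tending to $\infty$. Let $S_n=\sum_{j=0}^{n-1}g_j\circ\overline X_j$, and let $S_{n,\mu}$ and $S_{n,\nu}$ denote the random variable $S_n=S_n(x)$ when $x$ is distributed according to $\mu$ and $\nu$, respectively. Suppose there are exponents $p_1,p_2,p_3\ge1$ (where $p_1=\infty$ is allowed, with $\frac1\infty=0$) and a sequence $(M_j)$ of positive numbers such that $\frac1{p_1}+\frac1{p_2}+\frac1{p_3}=1$, $\|r\|_{L^{p_1}(\mu)}<\infty$ and $$\mathcal M_n:=\sum_{j=0}^{n-1}\left(M_j\delta_j+\|g_j\circ\overline X_j\|_{L^{p_2}(\mu)}^{1+p_2/p_3}M_j^{-p_2/p_3}\right)=o(b_n).$$ Then $|\mathbb E[S_{n,\nu}]-\mathbb E[S_{n,\mu}]|\le \mathcal M_n=o(b_n)$, and therefore $(S_{n,\nu}-\mathbb E[S_{n,\mu}])/b_n$ converges in distribution if and only if $(S_{n,\nu}-\mathbb E[S_{n,\nu}])/b_n$ converges in distribution, and to the same limit.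
   Context: $(\mathcal E,\mathcal F,\mu)$ is a probability space, $\mathcal X_0,\mathcal X_1,\dots$ are measurable spaces, and $X_j:\mathcal E\to\mathcal X_j$, $j\ge0$, are measurable maps. Set $\mathcal Y_n=\mathcal X_n\times\mathcal X_{n+1}\times\cdots$ and $\overline X_n(x)=(X_n(x),X_{n+1}(x),X_{n+2}(x),\dots)\in\mathcal Y_n$. For vector-valued $f$ on $\mathcal E$, $\|f\|_{L^p(\mu)}$ is the $L^p(\mu)$-norm of $|f|$. Assumption (DC): there is a sequence $(\delta_n)$ converging to $0$ and a set $B$ of real integrable functions on $\mathcal E$ equipped with a "norm" $\|\cdot\|$ such that for all $n$, all $s\in B$ and all bounded complex-valued functions $f=f(x_n,x_{n+1},\dots)$ on $\mathcal Y_n$, $$\left|\int s\cdot (f\circ\overline X_n)\,d\mu-\int s\,d\mu\cdot\int f\circ\overline X_n\,d\mu\right|\le \|s\|\,\|f\circ\overline X_n\|_{\infty}\,\delta_n,$$ where $\|f\circ\overline X_n\|_\infty$ is the essential supremum with respect to $\mu$.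
   Formalization: The printed bound |E[S_{n,ν}]−E[S_{n,μ}]| ≤ M_n fails in general (rescaling the norm and δ_n alters M_n); it is proved with the explicit factor max(‖r‖, 1+‖r‖_{L^{p1}(μ)}) in front of M_n; the o(b_n) claim and the equivalence of the limits are as printed. *)

theory Defs
  imports "HOL-Probability.Probability"
begin

text \<open>
  The spaces of the states \<open>x\<^sub>0, x\<^sub>1, \<dots>\<close> are measures \<open>\<X> 0, \<X> 1, \<dots>\<close>
  over one common type, of which only the carrier and the \<open>\<sigma>\<close>-algebra matter. A point
  \<open>(x\<^sub>n, x\<^sub>n\<^sub>+\<^sub>1, \<dots>)\<close> of the tail product is encoded as the sequence
  \<open>k \<mapsto> x\<^sub>n\<^sub>+\<^sub>k\<close>, so the index is shifted to start at \<open>0\<close>.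
\<close>

definition tail_space :: "(nat \<Rightarrow> 'x measure) \<Rightarrow> nat \<Rightarrow> (nat \<Rightarrow> 'x) measure" where
  "tail_space \<X> n = (\<Pi>\<^sub>M k\<in>UNIV. \<X> (n + k))"

definition tail_map :: "(nat \<Rightarrow> 'e \<Rightarrow> 'x) \<Rightarrow> nat \<Rightarrow> 'e \<Rightarrow> (nat \<Rightarrow> 'x)" where
  "tail_map X n x = (\<lambda>k. X (n + k) x)"

text \<open>The exponent \<open>p = \<top>\<close> gives the essential supremum of the norm.\<close>

definition Lp_norm :: "'e measure \<Rightarrow> ennreal \<Rightarrow> ('e \<Rightarrow> 'b::real_normed_vector) \<Rightarrow> ennreal" where
  "Lp_norm \<mu> p f =
    (if p = \<top> then esssup \<mu> (\<lambda>x. ennreal (norm (f x)))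
     else (let I = (\<integral>\<^sup>+ x. ennreal (norm (f x) powr enn2real p) \<partial>\<mu>)
           in if I = \<top> then \<top> else ennreal (enn2real I powr (1 / enn2real p))))"

text \<open>
  \<open>N\<close> is the ``norm'' on \<open>B\<close>. As \<open>B\<close> is only a set of functions, nothing but
  nonnegativity is required of it. The rate \<open>\<delta>\<close> is nonnegative; this follows from the
  inequality for \<open>f = 1\<close> as soon as some \<open>s \<in> B\<close> has \<open>N s > 0\<close>.
\<close>

definition decay_of_correlations ::
  "'e measure \<Rightarrow> (nat \<Rightarrow> 'x measure) \<Rightarrow> (nat \<Rightarrow> 'e \<Rightarrow> 'x) \<Rightarrow>
   (nat \<Rightarrow> real) \<Rightarrow> ('e \<Rightarrow> real) set \<Rightarrow> (('e \<Rightarrow> real) \<Rightarrow> real) \<Rightarrow> bool" where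
  "decay_of_correlations \<mu> \<X> X \<delta> B N \<longleftrightarrow>
     (\<forall>n. 0 \<le> \<delta> n) \<and> \<delta> \<longlonglongrightarrow> 0 \<and>
     (\<forall>s\<in>B. integrable \<mu> s \<and> 0 \<le> N s) \<and>
     (\<forall>n. \<forall>s\<in>B. \<forall>f :: (nat \<Rightarrow> 'x) \<Rightarrow> complex.
        f \<in> borel_measurable (tail_space \<X> n) \<longrightarrow>
        bounded (f ` space (tail_space \<X> n)) \<longrightarrow>
        cmod ((\<integral>x. complex_of_real (s x) * f (tail_map X n x) \<partial>\<mu>)
              - complex_of_real (\<integral>x. s x \<partial>\<mu>) * (\<integral>x. f (tail_map X n x) \<partial>\<mu>))
          \<le> N s * enn2real (Lp_norm \<mu> \<top> (\<lambda>x. f (tail_map X n x))) * \<delta> n)"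

definition partial_sum ::
  "(nat \<Rightarrow> 'e \<Rightarrow> 'x) \<Rightarrow> (nat \<Rightarrow> (nat \<Rightarrow> 'x) \<Rightarrow> 'b::comm_monoid_add) \<Rightarrow> nat \<Rightarrow> 'e \<Rightarrow> 'b" where
  "partial_sum X g n x = (\<Sum>j<n. g j (tail_map X j x))"

text \<open>
  The quantity \<open>\<M>\<^sub>n\<close>. It is meaningful only when the \<open>L\<^sup>p\<close>-norms
  (\<open>p = p2\<close>) are finite, since \<^const>\<open>enn2real\<close> sends \<open>\<top>\<close> to \<open>0\<close>.
\<close>

definition moment_bound ::
  "'e measure \<Rightarrow> (nat \<Rightarrow> 'e \<Rightarrow> 'x) \<Rightarrow> (nat \<Rightarrow> (nat \<Rightarrow> 'x) \<Rightarrow> 'b::real_normed_vector) \<Rightarrow>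
   (nat \<Rightarrow> real) \<Rightarrow> real \<Rightarrow> real \<Rightarrow> (nat \<Rightarrow> real) \<Rightarrow> nat \<Rightarrow> real" where
  "moment_bound \<mu> X g \<delta> p2 p3 M n =
     (\<Sum>j<n. M j * \<delta> j
        + enn2real (Lp_norm \<mu> (ennreal p2) (\<lambda>x. g j (tail_map X j x))) powr (1 + p2 / p3)
          * M j powr (- (p2 / p3)))"

text \<open>
  Convergence in distribution of the random variables \<open>Z n\<close> on \<open>P\<close> to the law \<open>L\<close>;
  the library's \<^const>\<open>weak_conv_m\<close> covers real random variables only.
\<close>

definition converges_in_distribution ::
  "'e measure \<Rightarrow> (nat \<Rightarrow> 'e \<Rightarrow> 'b::topological_space) \<Rightarrow> 'b measure \<Rightarrow> bool" where
  "converges_in_distribution P Z L \<longleftrightarrow>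
     prob_space L \<and> sets L = sets borel \<and> (\<forall>n. Z n \<in> borel_measurable P) \<and>
     (\<forall>\<phi> :: 'b \<Rightarrow> real. continuous_on UNIV \<phi> \<longrightarrow> bounded (range \<phi>) \<longrightarrow>
        (\<lambda>n. \<integral>y. \<phi> y \<partial>(distr P borel (Z n))) \<longlonglongrightarrow> (\<integral>y. \<phi> y \<partial>L))"

end

theory Submission
  imports Defs
begin

text \<open>
  Truncate \<open>h = g\<^sub>j \<circ> X\<^sub>j\<close> at height \<open>M\<^sub>j\<close>. The truncation is bounded by \<open>M\<^sub>j\<close>, so (DC) bounds
  its contribution to \<open>\<integral> r h d\<mu> - \<integral> h d\<mu>\<close> by \<open>\<parallel>r\<parallel> M\<^sub>j \<delta>\<^sub>j\<close>. On \<open>{|h| > M\<^sub>j}\<close> the triple Hoelder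
  inequality applied to \<open>r\<close>, \<open>h\<close> and the indicator of this set, together with Markov's inequality
  for \<open>|h|\<close> to the power \<open>p\<^sub>2\<close>, bounds the rest; the same estimate with \<open>r = 1\<close> handles the
  integral of \<open>h\<close> alone. Since the two centerings then differ by a deterministic \<open>o(b\<^sub>n)\<close> term,
  the equivalence is Slutsky's theorem.
\<close>

section \<open>Weighted Young and Hoelder inequalities for three factors\<close>

text \<open>The two-factor inequality is used twice: first to merge \<open>v\<close> and
  \<open>w\<close> into the weighted geometric mean \<open>y\<close> with weights
  \<open>b / s\<close> and \<open>c / s\<close>, then for \<open>u\<close> and \<open>y\<close>. The
  weight \<open>a = 0\<close> is allowed because it later encodes the exponent \<infinity>.\<close>

lemma Youngs_inequality_3:
  fixes a b c u v w :: real
  assumes "0 \<le> a" "0 \<le> b" "0 < c" "a + b + c = 1" "0 \<le> u" "0 \<le> v" "0 \<le> w"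
  shows "u powr a * v powr b * w powr c \<le> a * u + b * v + c * w"
proof (cases "u = 0 \<or> v = 0 \<or> w = 0")
  case True
  \<comment> \<open>\<open>0 powr x = 0\<close> for every \<open>x\<close>, including
    \<open>x = 0\<close>, so the left side vanishes even when \<open>u = 0\<close> and
    \<open>a = 0\<close>.\<close>
  with assms show ?thesis by auto
next
  case False
  with assms have pos: "0 < u" "0 < v" "0 < w" by auto
  define s where "s = b + c"
  have s: "0 < s" "a + s = 1" using assms by (auto simp: s_def)
  define y where "y = v powr (b / s) * w powr (c / s)"
  have "b / s + c / s = 1" using s by (simp add: s_def flip: add_divide_distrib)
  then have "y \<le> b / s * v + c / s * w"
    unfolding y_def using s assms pos by (intro Youngs_inequality_0) auto
  then have "s * y \<le> s * (b / s * v + c / s * w)" using s by (intro mult_left_mono) auto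
  also have "\<dots> = b * v + c * w" using s by (simp add: field_simps)
  finally have y: "s * y \<le> b * v + c * w" .
  have "u powr a * v powr b * w powr c = u powr a * y powr s"
    using s assms by (simp add: y_def powr_mult powr_powr)
  also have "\<dots> \<le> a * u + s * y"
    using s assms pos by (intro Youngs_inequality_0) (auto simp: y_def)
  finally show ?thesis using y by linarith
qed

text \<open>Divide each function by its integral and integrate Young's inequality pointwise; the
  right side then integrates to \<open>a + b + c = 1\<close>. The weights are reciprocal exponents
  and \<open>u\<close>, \<open>v\<close>, \<open>w\<close> stand for the powers already taken, so no
  conjugate exponent has to be named.\<close>

lemma Holder_inequality_3:
  fixes a b c :: real and u v w :: "'a \<Rightarrow> real"
  assumes "0 \<le> a" "0 < b" "0 < c" "a + b + c = 1"
    and u: "integrable M u" "\<And>x. 0 \<le> u x"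
    and v: "integrable M v" "\<And>x. 0 \<le> v x"
    and w: "integrable M w" "\<And>x. 0 \<le> w x"
  shows "integrable M (\<lambda>x. u x powr a * v x powr b * w x powr c)" (is "integrable M ?f")
    and "(\<integral>x. u x powr a * v x powr b * w x powr c \<partial>M)
      \<le> (\<integral>x. u x \<partial>M) powr a * (\<integral>x. v x \<partial>M) powr b * (\<integral>x. w x \<partial>M) powr c"
proof -
  note [measurable] = borel_measurable_integrable[OF u(1)] borel_measurable_integrable[OF v(1)]
    borel_measurable_integrable[OF w(1)]
  have Y: "u x powr a * v x powr b * w x powr c \<le> a * u x + b * v x + c * w x" for x
    using assms by (intro Youngs_inequality_3) auto
  show int: "integrable M ?f"
  proof (rule Bochner_Integration.integrable_bound)
    show "integrable M (\<lambda>x. a * u x + b * v x + c * w x)" using u v w by auto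
    show "AE x in M. norm (?f x) \<le> norm (a * u x + b * v x + c * w x)"
      using Y order_trans[OF Y abs_ge_self] by (auto simp: abs_mult)
  qed measurable
  let ?U = "\<integral>x. u x \<partial>M" and ?V = "\<integral>x. v x \<partial>M" and ?W = "\<integral>x. w x \<partial>M"
  have nn: "0 \<le> ?U" "0 \<le> ?V" "0 \<le> ?W" using u v w by auto
  show "integral\<^sup>L M ?f \<le> ?U powr a * ?V powr b * ?W powr c"
  proof (cases "?U = 0 \<or> ?V = 0 \<or> ?W = 0")
    case True
    \<comment> \<open>Normalization is impossible here, but a nonnegative function with integral
      zero vanishes almost everywhere, and with it the product.\<close>
    then have "(AE x in M. u x = 0) \<or> (AE x in M. v x = 0) \<or> (AE x in M. w x = 0)"
      using integral_nonneg_eq_0_iff_AE[OF u(1)] integral_nonneg_eq_0_iff_AE[OF v(1)]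
        integral_nonneg_eq_0_iff_AE[OF w(1)] u v w by auto
    then have "AE x in M. ?f x = 0" by (elim disjE) (auto elim!: eventually_mono)
    then have "integral\<^sup>L M ?f = 0" by (rule integral_eq_zero_AE)
    then show ?thesis by simp
  next
    case False
    with nn have pos: "0 < ?U" "0 < ?V" "0 < ?W" by auto
    let ?P = "?U powr a * ?V powr b * ?W powr c"
    have P: "0 < ?P" using pos by auto
    have "integral\<^sup>L M ?f / ?P = (\<integral>x. ?f x / ?P \<partial>M)" by simp
    also have "\<dots> \<le> (\<integral>x. a * (u x / ?U) + b * (v x / ?V) + c * (w x / ?W) \<partial>M)"
    proof (rule integral_mono)
      show "integrable M (\<lambda>x. ?f x / ?P)" using int by auto
      show "integrable M (\<lambda>x. a * (u x / ?U) + b * (v x / ?V) + c * (w x / ?W))"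
        using u v w by auto
      fix x
      have "?f x / ?P = (u x / ?U) powr a * (v x / ?V) powr b * (w x / ?W) powr c"
        using u v w pos by (simp add: powr_divide)
      also have "\<dots> \<le> a * (u x / ?U) + b * (v x / ?V) + c * (w x / ?W)"
        using assms pos by (intro Youngs_inequality_3) auto
      finally show "?f x / ?P \<le> a * (u x / ?U) + b * (v x / ?V) + c * (w x / ?W)" .
    qed
    also have "\<dots> = a + b + c" using u v w pos by simp
    finally show ?thesis using P assms by (simp add: divide_le_eq)
  qed
qed

section \<open>Finite Lp norms and the tail estimate\<close>

lemma Lp_norm_finite_exponent:
  assumes "1 \<le> p" and [measurable]: "f \<in> borel_measurable M" and fin: "Lp_norm M (ennreal p) f < \<top>"
  shows "integrable M (\<lambda>x. norm (f x) powr p)"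
    and "enn2real (Lp_norm M (ennreal p) f) = (\<integral>x. norm (f x) powr p \<partial>M) powr (1 / p)"
proof -
  let ?I = "\<integral>\<^sup>+ x. ennreal (norm (f x) powr p) \<partial>M"
  have I: "?I \<noteq> \<top>" using fin assms(1) by (auto simp: Lp_norm_def Let_def split: if_splits)
  then show int: "integrable M (\<lambda>x. norm (f x) powr p)"
    by (intro integrableI_nonneg) (auto simp: less_top)
  have "enn2real ?I = (\<integral>x. norm (f x) powr p \<partial>M)"
    by (subst integral_eq_nn_integral) auto
  with I assms(1) show "enn2real (Lp_norm M (ennreal p) f) = (\<integral>x. norm (f x) powr p \<partial>M) powr (1 / p)"
    by (simp add: Lp_norm_def Let_def)
qed

text \<open>This allows the constant function 1 in place of the density \<open>r\<close> in the
  Hoelder bounds below, with any exponent \<open>p1\<close>, which yields the estimates for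
  \<open>h\<close> alone.\<close>

lemma (in prob_space) Lp_norm_one:
  assumes "1 \<le> p"
  shows "Lp_norm M p (\<lambda>x. 1::real) = 1"
proof (cases p)
  case (real q)
  then show ?thesis by (simp add: Lp_norm_def emeasure_space_1)
next
  case top
  then show ?thesis by (simp add: Lp_norm_def esssup_const emeasure_space_1)
qed

text \<open>Triple Hoelder for \<open>r\<close>, \<open>h\<close> and the indicator of
  \<open>A\<close>, whose norm for the exponent \<open>p3\<close> is
  \<open>prob A powr (1 / p3)\<close>. With \<open>A = space M\<close> it gives integrability of the
  product, with a small \<open>A\<close> a gain from the measure of \<open>A\<close>.\<close>

lemma (in prob_space) Holder_indicator:
  fixes r :: "'a \<Rightarrow> real" and h :: "'a \<Rightarrow> 'b::{banach, second_countable_topology}"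
  assumes [measurable]: "r \<in> borel_measurable M" "h \<in> borel_measurable M" "A \<in> sets M"
    and p: "1 \<le> p1" "1 \<le> p2" "1 \<le> p3" "1 / p1 + 1 / ennreal p2 + 1 / ennreal p3 = 1"
    and fin: "Lp_norm M p1 r < \<top>" "Lp_norm M (ennreal p2) h < \<top>"
  shows "integrable M (\<lambda>x. indicator A x * (\<bar>r x\<bar> * norm (h x)))"
    and "(\<integral>x. indicator A x * (\<bar>r x\<bar> * norm (h x)) \<partial>M)
      \<le> enn2real (Lp_norm M p1 r) * enn2real (Lp_norm M (ennreal p2) h) * prob A powr (1 / p3)"
proof -
  let ?H = "\<integral>x. norm (h x) powr p2 \<partial>M"
  note h = Lp_norm_finite_exponent[OF p(2) _ fin(2)]
  have pos: "0 < 1 / p2" "0 < 1 / p3" "p2 \<noteq> 0" "p3 \<noteq> 0" using p by auto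
  have ind: "integrable M (\<lambda>x. indicator A x :: real)" "(\<integral>x. indicator A x \<partial>M) = prob A"
    by (auto simp: less_top[symmetric])
  have inv: "1 / ennreal p2 + 1 / ennreal p3 = ennreal (1 / p2 + 1 / p3)"
    using p by (simp add: divide_ennreal flip: ennreal_1 ennreal_plus)
  have "integrable M (\<lambda>x. indicator A x * (\<bar>r x\<bar> * norm (h x))) \<and>
    (\<integral>x. indicator A x * (\<bar>r x\<bar> * norm (h x)) \<partial>M)
      \<le> enn2real (Lp_norm M p1 r) * ?H powr (1 / p2) * prob A powr (1 / p3)"
  proof (cases p1)
    case (real p)
    have p': "1 \<le> p" using p(1) real by (simp flip: ennreal_1)
    have "ennreal (1 / p + (1 / p2 + 1 / p3)) = 1"
      using p(4) p' p(2,3) unfolding real add.assoc inv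
      by (simp add: divide_ennreal flip: ennreal_1 ennreal_plus)
    then have sum: "1 / p + 1 / p2 + 1 / p3 = 1" by simp
    note r = Lp_norm_finite_exponent[OF p' _ fin(1)[unfolded real]]
    \<comment> \<open>Each factor is a root of its own power, and an indicator equals all its
      positive powers; this is the shape of \<open>Holder_inequality_3\<close>.\<close>
    have eq: "indicator A x * (\<bar>r x\<bar> * norm (h x)) = (norm (r x) powr p) powr (1 / p)
        * (norm (h x) powr p2) powr (1 / p2) * indicator A x powr (1 / p3)" for x
      using p' pos by (simp add: powr_powr indicator_def)
    show ?thesis
      using Holder_inequality_3[of "1 / p" "1 / p2" "1 / p3" M "\<lambda>x. norm (r x) powr p"
          "\<lambda>x. norm (h x) powr p2" "indicator A"] p' pos sum r h ind
      unfolding eq real by simp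
  next
    case top
    let ?R = "enn2real (Lp_norm M p1 r)"
    have "ennreal (1 / p2 + 1 / p3) = 1"
      using p(4) unfolding top add.assoc inv by simp
    then have sum: "0 + 1 / p2 + 1 / p3 = 1" by simp
    \<comment> \<open>For \<open>p1 = \<top>\<close> the constant 1 with weight 0 takes the place of
      \<open>r\<close>, which is instead bounded almost everywhere by its essential supremum
      \<open>?R\<close>.\<close>
    have eq: "indicator A x * norm (h x) = 1 powr 0
        * (norm (h x) powr p2) powr (1 / p2) * indicator A x powr (1 / p3)" for x
      using pos by (simp add: powr_powr indicator_def)
    have H: "integrable M (\<lambda>x. indicator A x * norm (h x))"
      "(\<integral>x. indicator A x * norm (h x) \<partial>M) \<le> ?H powr (1 / p2) * prob A powr (1 / p3)"
      using Holder_inequality_3[of 0 "1 / p2" "1 / p3" M "\<lambda>x. 1"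
          "\<lambda>x. norm (h x) powr p2" "indicator A"] pos sum h ind
      unfolding eq by (auto simp: prob_space)
    have "AE x in M. ennreal (norm (r x)) \<le> Lp_norm M p1 r"
      using esssup_AE[where M=M and f="\<lambda>x. ennreal (norm (r x))"] by (simp add: Lp_norm_def top)
    then have R: "AE x in M. \<bar>r x\<bar> \<le> ?R"
    proof eventually_elim
      case (elim x)
      then show ?case using enn2real_mono[OF elim fin(1)] by simp
    qed
    then have le: "AE x in M. indicator A x * (\<bar>r x\<bar> * norm (h x)) \<le> ?R * (indicator A x * norm (h x))"
      by eventually_elim (auto simp: indicator_def mult_right_mono)
    have int: "integrable M (\<lambda>x. indicator A x * (\<bar>r x\<bar> * norm (h x)))"
      by (rule Bochner_Integration.integrable_bound[where f="\<lambda>x. ?R * (indicator A x * norm (h x))"])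
        (use H le in \<open>auto simp: abs_mult elim!: eventually_mono\<close>)
    have "(\<integral>x. indicator A x * (\<bar>r x\<bar> * norm (h x)) \<partial>M) \<le> (\<integral>x. ?R * (indicator A x * norm (h x)) \<partial>M)"
      using int H le by (intro integral_mono_AE) auto
    also have "\<dots> \<le> ?R * (?H powr (1 / p2) * prob A powr (1 / p3))"
      using H by (auto intro!: mult_left_mono)
    finally show ?thesis using int by (simp add: mult.assoc)
  qed
  then show "integrable M (\<lambda>x. indicator A x * (\<bar>r x\<bar> * norm (h x)))"
    and "(\<integral>x. indicator A x * (\<bar>r x\<bar> * norm (h x)) \<partial>M)
      \<le> enn2real (Lp_norm M p1 r) * enn2real (Lp_norm M (ennreal p2) h) * prob A powr (1 / p3)"
    using h by simp_all
qed

text \<open>Markov's inequality bounds the probability of the tail event by the \<open>p2\<close>-th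
  moment of \<open>h\<close> times \<open>m powr (- p2)\<close>. Its power \<open>1 / p3\<close>
  contributes \<open>p2 / p3\<close> further powers of the norm of \<open>h\<close> to the one from
  Hoelder, hence the exponent \<open>1 + p2 / p3\<close>.\<close>

lemma (in prob_space) Holder_tail:
  fixes r :: "'a \<Rightarrow> real" and h :: "'a \<Rightarrow> 'b::{banach, second_countable_topology}"
  assumes [measurable]: "r \<in> borel_measurable M" "h \<in> borel_measurable M"
    and p: "1 \<le> p1" "1 \<le> p2" "1 \<le> p3" "1 / p1 + 1 / ennreal p2 + 1 / ennreal p3 = 1"
    and fin: "Lp_norm M p1 r < \<top>" "Lp_norm M (ennreal p2) h < \<top>"
    and "0 < m"
  shows "(\<integral>x. indicator {x \<in> space M. m < norm (h x)} x * (\<bar>r x\<bar> * norm (h x)) \<partial>M)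
      \<le> enn2real (Lp_norm M p1 r)
          * (enn2real (Lp_norm M (ennreal p2) h) powr (1 + p2 / p3) * m powr (- (p2 / p3)))"
proof -
  let ?A = "{x \<in> space M. m < norm (h x)}" and ?I = "\<integral>x. norm (h x) powr p2 \<partial>M"
  let ?R = "enn2real (Lp_norm M p1 r)" and ?H = "enn2real (Lp_norm M (ennreal p2) h)"
  have A: "?A \<in> sets M" by measurable
  note h = Lp_norm_finite_exponent[OF p(2) _ fin(2)]
  have "m powr p2 * prob ?A = (\<integral>x. m powr p2 * indicator ?A x \<partial>M)" by simp
  also have "\<dots> \<le> ?I"
  proof (rule integral_mono)
    show "integrable M (\<lambda>x. m powr p2 * indicator ?A x)"
      using A by (auto simp: less_top[symmetric])
    show "integrable M (\<lambda>x. norm (h x) powr p2)" using h by simp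
    show "m powr p2 * indicator ?A x \<le> norm (h x) powr p2" for x
      using \<open>0 < m\<close> p by (auto simp: indicator_def intro!: powr_mono2)
  qed
  finally have "prob ?A \<le> ?I * m powr (- p2)"
    using \<open>0 < m\<close> by (simp add: powr_minus field_simps)
  then have "prob ?A powr (1 / p3) \<le> (?I * m powr (- p2)) powr (1 / p3)"
    using p by (intro powr_mono2) auto
  also have "\<dots> = ?H powr (p2 / p3) * m powr (- (p2 / p3))"
    using h p by (simp add: powr_mult powr_powr)
  finally have P: "prob ?A powr (1 / p3) \<le> ?H powr (p2 / p3) * m powr (- (p2 / p3))" .
  have "(\<integral>x. indicator ?A x * (\<bar>r x\<bar> * norm (h x)) \<partial>M) \<le> ?R * ?H * prob ?A powr (1 / p3)"
    by (rule Holder_indicator) (use A p fin in auto)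
  also have "\<dots> \<le> ?R * ?H * (?H powr (p2 / p3) * m powr (- (p2 / p3)))"
    using P by (intro mult_left_mono) auto
  also have "\<dots> = ?R * (?H powr (1 + p2 / p3) * m powr (- (p2 / p3)))"
    by (simp add: powr_add)
  finally show ?thesis .
qed

section \<open>Decay of correlations for unbounded vector-valued functions\<close>

lemma measurable_tail_map:
  assumes "\<And>j. X j \<in> measurable M (\<X> j)"
  shows "tail_map X n \<in> measurable M (tail_space \<X> n)"
proof -
  have "(\<lambda>x k. X (n + k) x) \<in> measurable M (\<Pi>\<^sub>M k\<in>UNIV. \<X> (n + k))"
    using assms by (intro measurable_PiM_single') (auto dest: measurable_space)
  then show ?thesis by (simp add: tail_space_def tail_map_def[abs_def])
qed

text \<open>
  Testing the scalar inequality on the component of \<open>f\<close> along the difference vector itself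
  loses no dimensional constant.
\<close>

lemma (in prob_space) decay_of_correlations_vector:
  fixes f :: "(nat \<Rightarrow> 'x) \<Rightarrow> 'b::euclidean_space"
  assumes X: "\<And>j. X j \<in> measurable M (\<X> j)"
    and dc: "decay_of_correlations M \<X> X \<delta> B N"
    and f[measurable]: "f \<in> borel_measurable (tail_space \<X> n)"
    and bd: "\<And>y. norm (f y) \<le> m"
    and s: "s \<in> B"
  shows "norm ((\<integral>x. s x *\<^sub>R f (tail_map X n x) \<partial>M) - (\<integral>x. s x \<partial>M) *\<^sub>R (\<integral>x. f (tail_map X n x) \<partial>M))
    \<le> N s * (m * \<delta> n)" (is "norm ?v \<le> _")
proof -
  note T[measurable] = measurable_tail_map[OF X, where n=n]
  have s': "integrable M s" "0 \<le> N s" and \<delta>: "0 \<le> \<delta> n"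
    using dc s by (auto simp: decay_of_correlations_def)
  note [measurable] = borel_measurable_integrable[OF s'(1)]
  have m: "0 \<le> m" using bd[of undefined] norm_ge_zero order_trans by blast
  have intf: "integrable M (\<lambda>x. f (tail_map X n x))"
    by (rule integrable_const_bound[of _ m]) (use bd in auto)
  have intsf: "integrable M (\<lambda>x. s x *\<^sub>R f (tail_map X n x))"
  proof (rule Bochner_Integration.integrable_bound)
    show "integrable M (\<lambda>x. m * s x)" using s' by simp
    show "AE x in M. norm (s x *\<^sub>R f (tail_map X n x)) \<le> norm (m * s x)"
      using bd m by (auto simp: abs_mult mult.commute[of m] intro!: mult_left_mono)
  qed measurable
  \<comment> \<open>The unit vector along the difference, or 0 if the difference is 0; in both cases
    pairing with \<open>u\<close> recovers the norm of the difference and keeps \<open>f\<close>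
    bounded by \<open>m\<close>.\<close>
  define u where "u = sgn ?v"
  have u: "norm u \<le> 1" by (simp add: u_def norm_sgn)
  define F where "F y = complex_of_real (f y \<bullet> u)" for y
  have F: "cmod (F y) \<le> m" for y
    using Cauchy_Schwarz_ineq2[of "f y" u] mult_mono[OF bd[of y] u] m by (simp add: F_def)
  have F_meas[measurable]: "F \<in> borel_measurable (tail_space \<X> n)"
    unfolding F_def[abs_def] by measurable
  have "Lp_norm M \<top> (\<lambda>x. F (tail_map X n x)) \<le> ennreal m"
    unfolding Lp_norm_def using F by (auto intro!: esssup_I ennreal_leI)
  then have L: "enn2real (Lp_norm M \<top> (\<lambda>x. F (tail_map X n x))) \<le> m"
    using m by (simp add: enn2real_leI)
  have "norm v = v \<bullet> sgn v" for v :: 'b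
    by (cases "v = 0") (simp_all add: sgn_div_norm dot_square_norm power2_eq_square)
  then have "norm ?v = ?v \<bullet> u" by (simp add: u_def)
  also have "\<dots> = (\<integral>x. s x * (f (tail_map X n x) \<bullet> u) \<partial>M)
      - (\<integral>x. s x \<partial>M) * (\<integral>x. f (tail_map X n x) \<bullet> u \<partial>M)"
    using intf integral_inner_left[OF intsf, of u] by (simp add: inner_diff_left)
  also have "\<dots> \<le> cmod (complex_of_real \<dots>)" unfolding norm_of_real by (rule abs_ge_self)
  also have "complex_of_real ((\<integral>x. s x * (f (tail_map X n x) \<bullet> u) \<partial>M)
      - (\<integral>x. s x \<partial>M) * (\<integral>x. f (tail_map X n x) \<bullet> u \<partial>M))
    = (\<integral>x. complex_of_real (s x) * F (tail_map X n x) \<partial>M)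
      - complex_of_real (\<integral>x. s x \<partial>M) * (\<integral>x. F (tail_map X n x) \<partial>M)"
    unfolding F_def by (simp flip: of_real_mult)
  also have "cmod \<dots> \<le> N s * enn2real (Lp_norm M \<top> (\<lambda>x. F (tail_map X n x))) * \<delta> n"
  proof -
    have "bounded (F ` space (tail_space \<X> n))" using F by (auto simp: bounded_iff)
    then show ?thesis using dc s F_meas unfolding decay_of_correlations_def by blast
  qed
  also have "\<dots> \<le> N s * m * \<delta> n"
    using L s' \<delta> by (intro mult_right_mono mult_left_mono) auto
  finally show ?thesis by (simp add: mult.assoc)
qed

text \<open>The summand is a truncated part, controlled by (DC), plus a tail. The tail enters twice,
  weighted by \<open>r\<close> and unweighted, which produces the factor
  \<open>1 + ?R\<close>.\<close>

lemma (in prob_space) decay_of_correlations_term: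
  fixes g :: "(nat \<Rightarrow> 'x) \<Rightarrow> 'b::euclidean_space"
  assumes X: "\<And>j. X j \<in> measurable M (\<X> j)"
    and dc: "decay_of_correlations M \<X> X \<delta> B N"
    and g[measurable]: "g \<in> borel_measurable (tail_space \<X> n)"
    and r: "r \<in> B" "AE x in M. 0 \<le> r x" "(\<integral>x. r x \<partial>M) = 1"
    and p: "1 \<le> p1" "1 \<le> p2" "1 \<le> p3" "1 / p1 + 1 / ennreal p2 + 1 / ennreal p3 = 1"
    and fin: "Lp_norm M p1 r < \<top>" "Lp_norm M (ennreal p2) (\<lambda>x. g (tail_map X n x)) < \<top>"
    and m: "0 < m"
  shows "integrable M (\<lambda>x. g (tail_map X n x))"
    and "integrable M (\<lambda>x. r x *\<^sub>R g (tail_map X n x))"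
    and "norm ((\<integral>x. r x *\<^sub>R g (tail_map X n x) \<partial>M) - (\<integral>x. g (tail_map X n x) \<partial>M))
      \<le> N r * (m * \<delta> n) + (1 + enn2real (Lp_norm M p1 r))
        * (enn2real (Lp_norm M (ennreal p2) (\<lambda>x. g (tail_map X n x))) powr (1 + p2 / p3)
            * m powr (- (p2 / p3)))" (is "_ \<le> _ + (1 + ?R) * ?K")
proof -
  note T[measurable] = measurable_tail_map[OF X, where n=n]
  have intr: "integrable M r" using dc r by (auto simp: decay_of_correlations_def)
  note [measurable] = borel_measurable_integrable[OF intr]
  define h where "h x = g (tail_map X n x)" for x
  have h[measurable]: "h \<in> borel_measurable M" unfolding h_def[abs_def] by measurable
  have finh: "Lp_norm M (ennreal p2) h < \<top>" using fin by (simp add: h_def[abs_def])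
  have one: "Lp_norm M p1 (\<lambda>x. 1::real) = 1" using p by (intro Lp_norm_one)
  \<comment> \<open>The indicator of the whole space and the weight 1 turn the Hoelder bound into
    integrability of \<open>h\<close>; the weight \<open>r\<close> then does the same for the
    product.\<close>
  have inth: "integrable M h"
    using Holder_indicator(1)[of "\<lambda>x. 1" h "space M", OF _ _ _ p _ finh] one
    by (intro integrable_norm_cancel[of M h])
      (auto cong: Bochner_Integration.integrable_cong)
  have intrh: "integrable M (\<lambda>x. r x *\<^sub>R h x)"
    using Holder_indicator(1)[of r h "space M", OF _ _ _ p fin(1) finh]
    by (intro integrable_norm_cancel[of M "\<lambda>x. r x *\<^sub>R h x"])
      (auto cong: Bochner_Integration.integrable_cong)
  show "integrable M (\<lambda>x. g (tail_map X n x))" "integrable M (\<lambda>x. r x *\<^sub>R g (tail_map X n x))"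
    using inth intrh by (simp_all add: h_def[abs_def])
  \<comment> \<open>The truncation is made on the sequence space, since (DC) speaks of functions of
    the tail sequence. Large values are replaced by 0 rather than rescaled, so the remainder is
    exactly \<open>h\<close> times the indicator of \<open>?A\<close>.\<close>
  define f where "f y = (if norm (g y) \<le> m then g y else 0)" for y
  have f[measurable]: "f \<in> borel_measurable (tail_space \<X> n)"
    unfolding f_def[abs_def] by measurable
  have fm: "norm (f y) \<le> m" for y using m by (simp add: f_def)
  define F where "F x = f (tail_map X n x)" for x
  have F[measurable]: "F \<in> borel_measurable M" unfolding F_def[abs_def] by measurable
  let ?A = "{x \<in> space M. m < norm (h x)}"
  have split: "h x = F x + indicator ?A x *\<^sub>R h x" if "x \<in> space M" for x
    using that by (auto simp: F_def f_def h_def indicator_def)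
  have A: "?A \<in> sets M" by measurable
  let ?t = "\<lambda>x. indicator ?A x *\<^sub>R h x"
  have intt: "integrable M ?t" using A inth by (rule integrable_mult_indicator)
  have intrt: "integrable M (\<lambda>x. r x *\<^sub>R ?t x)"
    using integrable_mult_indicator[OF A intrh] by (simp add: mult.commute)
  have intF: "integrable M F"
    by (rule integrable_const_bound[of _ m]) (use fm in \<open>auto simp: F_def\<close>)
  have intrF: "integrable M (\<lambda>x. r x *\<^sub>R F x)"
  proof (rule Bochner_Integration.integrable_bound)
    show "integrable M (\<lambda>x. m * r x)" using intr by simp
    show "AE x in M. norm (r x *\<^sub>R F x) \<le> norm (m * r x)"
      using fm m by (auto simp: F_def abs_mult mult.commute[of m] intro!: mult_left_mono)
  qed measurable
  have "(\<integral>x. h x \<partial>M) = (\<integral>x. F x + ?t x \<partial>M)"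
    using split by (intro Bochner_Integration.integral_cong) auto
  also have "\<dots> = (\<integral>x. F x \<partial>M) + (\<integral>x. ?t x \<partial>M)" using intF intt by simp
  finally have sh: "(\<integral>x. h x \<partial>M) = (\<integral>x. F x \<partial>M) + (\<integral>x. ?t x \<partial>M)" .
  have "(\<integral>x. r x *\<^sub>R h x \<partial>M) = (\<integral>x. r x *\<^sub>R F x + r x *\<^sub>R ?t x \<partial>M)"
    unfolding scaleR_add_right[symmetric]
    using split by (intro Bochner_Integration.integral_cong) auto
  also have "\<dots> = (\<integral>x. r x *\<^sub>R F x \<partial>M) + (\<integral>x. r x *\<^sub>R ?t x \<partial>M)"
    using intrF intrt by (rule Bochner_Integration.integral_add)
  finally have srh: "(\<integral>x. r x *\<^sub>R h x \<partial>M) = (\<integral>x. r x *\<^sub>R F x \<partial>M) + (\<integral>x. r x *\<^sub>R ?t x \<partial>M)" .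
  have K: "?K = enn2real (Lp_norm M (ennreal p2) h) powr (1 + p2 / p3) * m powr (- (p2 / p3))"
    by (simp add: h_def[abs_def])
  have 1: "norm ((\<integral>x. r x *\<^sub>R F x \<partial>M) - (\<integral>x. F x \<partial>M)) \<le> N r * (m * \<delta> n)"
    using decay_of_correlations_vector[OF X dc f fm r(1)] r(3) by (simp add: F_def[abs_def])
  have "norm (\<integral>x. r x *\<^sub>R ?t x \<partial>M) \<le> (\<integral>x. norm (r x *\<^sub>R ?t x) \<partial>M)"
    by (rule integral_norm_bound)
  also have "\<dots> = (\<integral>x. indicator ?A x * (\<bar>r x\<bar> * norm (h x)) \<partial>M)"
    by (intro Bochner_Integration.integral_cong) (auto simp: indicator_def)
  also have "\<dots> \<le> ?R * ?K"
    unfolding K using Holder_tail[OF _ h p fin(1) finh m] by simp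
  finally have 2: "norm (\<integral>x. r x *\<^sub>R ?t x \<partial>M) \<le> ?R * ?K" .
  have "norm (\<integral>x. ?t x \<partial>M) \<le> (\<integral>x. norm (?t x) \<partial>M)"
    by (rule integral_norm_bound)
  also have "\<dots> = (\<integral>x. indicator ?A x * (\<bar>1\<bar> * norm (h x)) \<partial>M)"
    by (intro Bochner_Integration.integral_cong) (auto simp: indicator_def)
  also have "\<dots> \<le> ?K"
    unfolding K using Holder_tail[OF _ h p _ finh m, of "\<lambda>x. 1"] one by simp
  finally have 3: "norm (\<integral>x. ?t x \<partial>M) \<le> ?K" .
  have "(\<integral>x. r x *\<^sub>R h x \<partial>M) - (\<integral>x. h x \<partial>M) =
      ((\<integral>x. r x *\<^sub>R F x \<partial>M) - (\<integral>x. F x \<partial>M)) + ((\<integral>x. r x *\<^sub>R ?t x \<partial>M) - (\<integral>x. ?t x \<partial>M))"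
    unfolding sh srh by simp
  then have "norm ((\<integral>x. r x *\<^sub>R h x \<partial>M) - (\<integral>x. h x \<partial>M)) \<le> N r * (m * \<delta> n) + (?R * ?K + ?K)"
    using 1 2 3 norm_triangle_ineq4[of "\<integral>x. r x *\<^sub>R ?t x \<partial>M" "\<integral>x. ?t x \<partial>M"]
    by (auto intro!: norm_triangle_le)
  also have "\<dots> = N r * (m * \<delta> n) + (1 + ?R) * ?K" by (simp add: algebra_simps)
  finally show "norm ((\<integral>x. r x *\<^sub>R g (tail_map X n x) \<partial>M) - (\<integral>x. g (tail_map X n x) \<partial>M))
      \<le> N r * (m * \<delta> n) + (1 + ?R) * ?K" by (simp add: h_def[abs_def])
qed

section \<open>Stability of convergence in distribution under vanishing shifts\<close>

text \<open>
  A test function is only uniformly continuous on bounded sets, so the mass of \<open>Z n\<close> outside a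
  ball is controlled by the expectation of a continuous cutoff \<open>\<psi>\<close>, which converges too.
\<close>

lemma converges_in_distribution_shift:
  fixes Z :: "nat \<Rightarrow> 'e \<Rightarrow> 'b::euclidean_space"
  assumes "prob_space P" and conv: "converges_in_distribution P Z L" and c: "c \<longlonglongrightarrow> 0"
  shows "converges_in_distribution P (\<lambda>n x. Z n x + c n) L"
proof -
  interpret P: prob_space P by fact
  from conv have "prob_space L" and setsL[measurable_cong]: "sets L = sets borel"
    and Z[measurable]: "\<And>n. Z n \<in> borel_measurable P"
    and lim: "\<And>\<phi> :: 'b \<Rightarrow> real. continuous_on UNIV \<phi> \<Longrightarrow> bounded (range \<phi>) \<Longrightarrow>
      (\<lambda>n. \<integral>y. \<phi> y \<partial>(distr P borel (Z n))) \<longlonglongrightarrow> (\<integral>y. \<phi> y \<partial>L)"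
    by (auto simp: converges_in_distribution_def)
  interpret L: prob_space L by fact
  \<comment> \<open>\<open>\<psi> k\<close> is 1 on the ball of radius \<open>k\<close>, 0 outside
    radius \<open>k + 1\<close>, and linear in the norm between.\<close>
  define \<psi> :: "nat \<Rightarrow> 'b \<Rightarrow> real" where "\<psi> k y = max 0 (min 1 (real k + 1 - norm y))" for k y
  have \<psi>_bounds: "0 \<le> \<psi> k y" "\<psi> k y \<le> 1" for k y by (auto simp: \<psi>_def)
  have \<psi>_cont: "continuous_on UNIV (\<psi> k)" for k
    unfolding \<psi>_def[abs_def] by (intro continuous_intros)
  have [measurable]: "\<psi> k \<in> borel_measurable borel" for k
    using \<psi>_cont by (rule borel_measurable_continuous_onI)
  have \<psi>_bounded: "bounded (range (\<psi> k))" for k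
    using \<psi>_bounds by (auto simp: bounded_iff intro!: exI[of _ 1])
  have \<psi>_int: "integrable P (\<lambda>x. \<psi> k (Z n x))" for k n
    by (rule P.integrable_const_bound[of _ 1]) (use \<psi>_bounds in auto)
  have tight: "(\<lambda>k. \<integral>y. \<psi> k y \<partial>L) \<longlonglongrightarrow> (\<integral>y. 1 \<partial>L)"
  proof (rule integral_dominated_convergence[where w="\<lambda>_. 1"])
    have "(\<lambda>k. \<psi> k y) \<longlonglongrightarrow> 1" for y
    proof (rule tendsto_eventually)
      obtain k0 where "norm y \<le> real k0" using real_arch_simple by blast
      then show "\<forall>\<^sub>F k in sequentially. \<psi> k y = 1"
        by (intro eventually_sequentiallyI[of k0]) (auto simp: \<psi>_def)
    qed
    then show "AE y in L. (\<lambda>k. \<psi> k y) \<longlonglongrightarrow> 1" by simp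
  qed (use \<psi>_bounds in auto)
  show ?thesis
    unfolding converges_in_distribution_def
  proof (intro conjI allI impI)
    fix \<phi> :: "'b \<Rightarrow> real"
    assume \<phi>: "continuous_on UNIV \<phi>" "bounded (range \<phi>)"
    then have \<phi>_meas[measurable]: "\<phi> \<in> borel_measurable borel"
      by (intro borel_measurable_continuous_onI)
    obtain K where K: "0 < K" "\<And>y. \<bar>\<phi> y\<bar> \<le> K"
      using \<phi>(2) by (auto simp: bounded_pos)
    have \<phi>_int: "integrable P (\<lambda>x. \<phi> (Z n x + a))" for n a
      by (rule P.integrable_const_bound[of _ K]) (use K in auto)
    have "(\<lambda>n. (\<integral>x. \<phi> (Z n x + c n) \<partial>P) - (\<integral>x. \<phi> (Z n x) \<partial>P)) \<longlonglongrightarrow> 0"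
    proof (rule LIMSEQ_I)
      fix \<epsilon> :: real assume "0 < \<epsilon>"
      \<comment> \<open>The final error will be \<open>e + 2 * K * e = Q * e\<close>; this choice of
        \<open>e\<close> makes it half of \<open>\<epsilon>\<close>.\<close>
      define Q where "Q = 1 + 2 * K"
      define e where "e = \<epsilon> / (2 * Q)"
      have Q: "0 < Q" using K by (simp add: Q_def)
      have e: "0 < e" "e + 2 * K * e < \<epsilon>"
      proof -
        show "0 < e" using Q \<open>0 < \<epsilon>\<close> by (simp add: e_def)
        have "e + 2 * K * e = Q * e" by (simp add: Q_def distrib_right)
        also have "\<dots> = \<epsilon> / 2" using Q by (simp add: e_def)
        finally show "e + 2 * K * e < \<epsilon>" using \<open>0 < \<epsilon>\<close> by simp
      qed
      have "\<forall>\<^sub>F k in sequentially. 1 - e < (\<integral>y. \<psi> k y \<partial>L)"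
        using tight e by (intro order_tendstoD(1)) (auto simp: L.prob_space)
      then obtain k where k: "1 - e < (\<integral>y. \<psi> k y \<partial>L)"
        by (auto dest: eventually_happens)
      have ev1: "\<forall>\<^sub>F n in sequentially. 1 - e < (\<integral>y. \<psi> k y \<partial>(distr P borel (Z n)))"
        using lim[OF \<psi>_cont \<psi>_bounded] k by (rule order_tendstoD(1))
      \<comment> \<open>The radius \<open>k + 2\<close> leaves room for a point of norm at most
        \<open>k + 1\<close>, where \<open>\<psi> k\<close> may be nonzero, to be shifted by less
        than 1.\<close>
      have "uniformly_continuous_on (cball 0 (real k + 2)) \<phi>"
        by (rule compact_uniformly_continuous) (use \<phi> continuous_on_subset in auto)
      then obtain d where d: "0 < d" "\<And>y z. norm y \<le> real k + 2 \<Longrightarrow> norm z \<le> real k + 2 \<Longrightarrow>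
          dist z y < d \<Longrightarrow> \<bar>\<phi> z - \<phi> y\<bar> < e"
        using e by (auto simp: uniformly_continuous_on_def dist_real_def)
      have ev2: "\<forall>\<^sub>F n in sequentially. norm (c n) < min d 1"
        using tendsto_norm_zero[OF c] d by (intro order_tendstoD(2)) auto
      have "\<forall>\<^sub>F n in sequentially. \<bar>(\<integral>x. \<phi> (Z n x + c n) \<partial>P) - (\<integral>x. \<phi> (Z n x) \<partial>P)\<bar> < \<epsilon>"
        using ev1 ev2
      proof eventually_elim
        case (elim n)
        \<comment> \<open>Within radius \<open>k + 1\<close> uniform continuity gives
          \<open>e\<close>. Beyond it the cutoff is 0 and the trivial bound \<open>2 * K\<close>
          applies. Integrated, the cutoff term is at most \<open>2 * K * e\<close> by
          \<open>ev1\<close>.\<close>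
        have pw: "\<bar>\<phi> (z + c n) - \<phi> z\<bar> \<le> e + 2 * K * (1 - \<psi> k z)" for z
        proof (cases "norm z \<le> real k + 1")
          case True
          have "norm (z + c n) \<le> real k + 2"
            using norm_triangle_ineq[of z "c n"] True elim by linarith
          then have "\<bar>\<phi> (z + c n) - \<phi> z\<bar> < e"
            using True elim by (intro d) (auto simp: dist_norm)
          moreover have "0 \<le> 2 * K * (1 - \<psi> k z)" using K \<psi>_bounds by auto
          ultimately show ?thesis by linarith
        next
          case False
          then have "\<psi> k z = 0" by (simp add: \<psi>_def)
          then show ?thesis using K(2)[of "z + c n"] K(2)[of z] e by simp
        qed
        have "\<bar>(\<integral>x. \<phi> (Z n x + c n) \<partial>P) - (\<integral>x. \<phi> (Z n x) \<partial>P)\<bar>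
            = \<bar>\<integral>x. \<phi> (Z n x + c n) - \<phi> (Z n x) \<partial>P\<bar>"
          using \<phi>_int[of n "c n"] \<phi>_int[of n 0] by simp
        also have "\<dots> \<le> (\<integral>x. \<bar>\<phi> (Z n x + c n) - \<phi> (Z n x)\<bar> \<partial>P)"
          by (rule integral_abs_bound)
        also have "\<dots> \<le> (\<integral>x. e + 2 * K * (1 - \<psi> k (Z n x)) \<partial>P)"
          using pw \<phi>_int[of n "c n"] \<phi>_int[of n 0] \<psi>_int by (intro integral_mono) auto
        also have "\<dots> = e + 2 * K * (1 - (\<integral>x. \<psi> k (Z n x) \<partial>P))"
          using \<psi>_int by (simp add: P.prob_space)
        also have "(\<integral>x. \<psi> k (Z n x) \<partial>P) = (\<integral>y. \<psi> k y \<partial>(distr P borel (Z n)))"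
          by (simp add: integral_distr)
        also have "e + 2 * K * (1 - \<dots>) \<le> e + 2 * K * e"
          using elim K by (intro add_left_mono mult_left_mono) auto
        finally show ?case using e by linarith
      qed
      then show "\<exists>n0. \<forall>n\<ge>n0.
          norm ((\<integral>x. \<phi> (Z n x + c n) \<partial>P) - (\<integral>x. \<phi> (Z n x) \<partial>P) - 0) < \<epsilon>"
        by (simp add: eventually_sequentially)
    qed
    from tendsto_add[OF this lim[OF \<phi>]]
    show "(\<lambda>n. \<integral>y. \<phi> y \<partial>(distr P borel (\<lambda>x. Z n x + c n))) \<longlonglongrightarrow> (\<integral>y. \<phi> y \<partial>L)"
      by (simp add: integral_distr)
  qed (use \<open>prob_space L\<close> setsL in auto)
qed

section \<open>Comparison of the expectations and change of centering\<close>

theorem proposition3p2: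
  fixes \<mu> \<nu> :: "'e measure"
    and \<X> :: "nat \<Rightarrow> 'x measure"
    and X :: "nat \<Rightarrow> 'e \<Rightarrow> 'x"
    and \<delta> b M :: "nat \<Rightarrow> real"
    and B :: "('e \<Rightarrow> real) set"
    and N :: "('e \<Rightarrow> real) \<Rightarrow> real"
    and g :: "nat \<Rightarrow> (nat \<Rightarrow> 'x) \<Rightarrow> real ^ 'd"
    and r :: "'e \<Rightarrow> real"
    and p1 :: ennreal
    and p2 p3 :: real
  assumes "prob_space \<mu>"
    and "\<And>j. X j \<in> measurable \<mu> (\<X> j)"
    and "decay_of_correlations \<mu> \<X> X \<delta> B N"
    and "\<And>j. g j \<in> borel_measurable (tail_space \<X> j)"
    and "r \<in> B" and "AE x in \<mu>. 0 \<le> r x" and "(\<integral>x. r x \<partial>\<mu>) = 1"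
    and "\<nu> = density \<mu> (\<lambda>x. ennreal (r x))"
    and "\<And>n. 0 < b n" and "filterlim b at_top sequentially"
    and "1 \<le> p1" and "1 \<le> p2" and "1 \<le> p3"
    and "1 / p1 + 1 / ennreal p2 + 1 / ennreal p3 = 1"
    and "Lp_norm \<mu> p1 r < \<top>"
    and "\<And>j. 0 < M j"
    and "\<And>j. Lp_norm \<mu> (ennreal p2) (\<lambda>x. g j (tail_map X j x)) < \<top>"
    and "moment_bound \<mu> X g \<delta> p2 p3 M \<in> o(b)"
  shows "(\<forall>n. integrable \<mu> (partial_sum X g n) \<and> integrable \<nu> (partial_sum X g n)
            \<and> norm ((\<integral>x. partial_sum X g n x \<partial>\<nu>) - (\<integral>x. partial_sum X g n x \<partial>\<mu>))
                \<le> max (N r) (1 + enn2real (Lp_norm \<mu> p1 r)) * moment_bound \<mu> X g \<delta> p2 p3 M n)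
       \<and> (\<lambda>n. norm ((\<integral>x. partial_sum X g n x \<partial>\<nu>) - (\<integral>x. partial_sum X g n x \<partial>\<mu>))) \<in> o(b)
       \<and> (\<forall>L. converges_in_distribution \<nu>
                (\<lambda>n x. (partial_sum X g n x - (\<integral>y. partial_sum X g n y \<partial>\<mu>)) /\<^sub>R b n) L
              \<longleftrightarrow> converges_in_distribution \<nu>
                (\<lambda>n x. (partial_sum X g n x - (\<integral>y. partial_sum X g n y \<partial>\<nu>)) /\<^sub>R b n) L)"
proof -
  interpret prob_space \<mu> by fact
  note X = assms(2) and dc = assms(3) and g = assms(4) and r = assms(5-7) and \<nu> = assms(8)
    and b = assms(9,10) and p = assms(11-14) and fin = assms(15) and M = assms(16)
    and fing = assms(17) and small = assms(18)
  have intr: "integrable \<mu> r" and Nr: "0 \<le> N r" and \<delta>: "\<And>n. 0 \<le> \<delta> n"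
    using dc r by (auto simp: decay_of_correlations_def)
  note r_meas[measurable] = borel_measurable_integrable[OF intr]
  note terms = decay_of_correlations_term[OF X dc g r p fin fing M]
  let ?S = "partial_sum X g" and ?m = "moment_bound \<mu> X g \<delta> p2 p3 M"
  let ?R = "enn2real (Lp_norm \<mu> p1 r)"
  \<comment> \<open>The (DC) part of each summand carries the factor \<open>N r\<close> and the tail
    part \<open>1 + ?R\<close>; their maximum serves both parts and all indices, so the bound sums
    to a multiple of the moment bound.\<close>
  define C where "C = max (N r) (1 + ?R)"
  define D where "D n = (\<integral>x. ?S n x \<partial>\<nu>) - (\<integral>x. ?S n x \<partial>\<mu>)" for n
  have S_int: "integrable \<mu> (?S n)" for n
    using terms(1) unfolding partial_sum_def[abs_def] by auto
  have S_meas: "?S n \<in> borel_measurable \<mu>" for n using S_int by auto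
  have rS: "r x *\<^sub>R ?S n x = (\<Sum>j<n. r x *\<^sub>R g j (tail_map X j x))" for n x
    by (simp add: partial_sum_def scaleR_right.sum)
  \<comment> \<open>Integrals under \<open>\<nu>\<close> are \<open>\<mu>\<close>-integrals weighted
    by \<open>r\<close>, and the weight distributes over the partial sum, so the estimates for
    single summands apply.\<close>
  have S_int\<nu>: "integrable \<nu> (?S n)" for n
    unfolding \<nu> integrable_density[OF S_meas r_meas r(2)] rS using terms(2) by auto
  have D: "D n = (\<Sum>j<n. (\<integral>x. r x *\<^sub>R g j (tail_map X j x) \<partial>\<mu>) - (\<integral>x. g j (tail_map X j x) \<partial>\<mu>))" for n
    unfolding D_def \<nu> integral_density[OF S_meas r_meas r(2)] rS
    using terms(1,2) by (simp add: partial_sum_def[abs_def] sum_subtractf)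
  have D_bound: "norm (D n) \<le> C * ?m n" for n
    unfolding D moment_bound_def sum_distrib_left
  proof (intro order_trans[OF norm_sum] sum_mono order_trans[OF terms(3)])
    fix j
    let ?K = "enn2real (Lp_norm \<mu> (ennreal p2) (\<lambda>x. g j (tail_map X j x))) powr (1 + p2 / p3)
      * M j powr - (p2 / p3)"
    have "N r * (M j * \<delta> j) \<le> C * (M j * \<delta> j)"
      using M[of j] \<delta>[of j] by (intro mult_right_mono) (auto simp: C_def)
    moreover have "(1 + ?R) * ?K \<le> C * ?K" by (intro mult_right_mono) (auto simp: C_def)
    ultimately show "N r * (M j * \<delta> j) + (1 + ?R) * ?K \<le> C * (M j * \<delta> j + ?K)"
      by (simp add: distrib_left)
  qed
  have "(\<lambda>n. norm (D n)) \<in> O(?m)"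
  proof (rule bigoI[of _ C], rule always_eventually, rule allI)
    fix n
    have "norm (D n) \<le> C * ?m n" by (rule D_bound)
    also have "\<dots> \<le> C * norm (?m n)" using Nr by (intro mult_left_mono) (auto simp: C_def)
    finally show "norm (norm (D n)) \<le> C * norm (?m n)" by simp
  qed
  then have D_small: "(\<lambda>n. norm (D n)) \<in> o(b)" using small by (rule landau_o.big_small_trans)
  have shift: "(\<lambda>n. D n /\<^sub>R b n) \<longlonglongrightarrow> 0"
  proof (rule tendsto_norm_zero_cancel)
    have "(\<lambda>n. norm (D n) / b n) \<longlonglongrightarrow> 0" using D_small by (rule smalloD_tendsto)
    then show "(\<lambda>n. norm (D n /\<^sub>R b n)) \<longlonglongrightarrow> 0"
      using b(1) by (simp add: less_imp_le divide_inverse_commute)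
  qed
  have prob\<nu>: "prob_space \<nu>"
  proof
    have "emeasure \<nu> (space \<nu>) = (\<integral>\<^sup>+ x. ennreal (r x) \<partial>\<mu>)"
      unfolding \<nu> by (auto simp: emeasure_density intro!: nn_integral_cong)
    also have "\<dots> = 1" using nn_integral_eq_integral[OF intr r(2)] r(3) by simp
    finally show "emeasure \<nu> (space \<nu>) = 1" .
  qed
  let ?Z\<mu> = "\<lambda>n x. (?S n x - (\<integral>y. ?S n y \<partial>\<mu>)) /\<^sub>R b n"
  let ?Z\<nu> = "\<lambda>n x. (?S n x - (\<integral>y. ?S n y \<partial>\<nu>)) /\<^sub>R b n"
  \<comment> \<open>The two normalized sequences differ by the deterministic vector
    \<open>D n /\<^sub>R b n\<close>, which tends to 0. Shifting by it and by its negative gives the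
    two implications for the same limit law.\<close>
  have eq1: "?Z\<mu> = (\<lambda>n x. ?Z\<nu> n x + D n /\<^sub>R b n)"
    and eq2: "?Z\<nu> = (\<lambda>n x. ?Z\<mu> n x + - (D n /\<^sub>R b n))"
    by (simp_all add: D_def fun_eq_iff flip: scaleR_add_right scaleR_minus_right)
  have "converges_in_distribution \<nu> ?Z\<mu> L \<longleftrightarrow> converges_in_distribution \<nu> ?Z\<nu> L" for L
    using converges_in_distribution_shift[OF prob\<nu>, of ?Z\<nu> L, OF _ shift]
      converges_in_distribution_shift[OF prob\<nu>, of ?Z\<mu> L, OF _ tendsto_minus[OF shift, simplified]]
    unfolding eq1[symmetric] eq2[symmetric] by blast
  then show ?thesis
    using S_int S_int\<nu> D_bound D_small unfolding D_def C_def by blast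
qed

end
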